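(* Consider the modified (penalized) semi-discrete Legendre-Fourier system for the Vlasov-Poisson equations $$\frac{d\mathbf{C}^s_k}{dt}+\Big(\frac{2\pi i}{L}k\Big)\mathbb{A}\mathbf{C}^s_k-\frac{q^s}{m^s}\Big[E\star\big(\mathbb{B}\mathbf{C}^s-\gamma^s\delta_v[f^s\boldsymbol\phi]_{v_a}^{v_b}\big)\Big]_k=\mathbb{D}^s_\nu\mathbf{C}^s_k,\qquad -N_F\le k\le N_F,\ s\in\{e,i\}.$$ For $\gamma^s=\tfrac12$ and any $\nu_s\ge0$ the method is $L^2$-stable, i.e. for every solution, each species $s$ and every $t\ge0$ in the interval of existence, $\sum_{n=0}^{N_L-1}\sum_{k=-N_F}^{N_F}|C^s_{n,k}(t)|^2\le\sum_{n=0}^{N_L-1}\sum_{k=-N_F}^{N_F}|C^s_{n,k}(0)|^2$. Moreover, the coefficients satisfy $$\frac{d}{dt}\sum_{n=0}^{N_L-1}\sum_{k=-N_F}^{N_F}|C^s_{n,k}(t)|^2=-2\sum_{n=0}^{N_L-1}|D^s_n|\sum_{k=-N_F}^{N_F}|C^s_{n,k}(t)|^2 .$$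
   Context: Let $L>0$, $v_a<v_b$, integers $N_L\ge4$, $N_F\ge0$; species $s\in\{e,i\}$ have mass $m^s>0$ and charge $q^s\in\mathbb{R}$; $\epsilon_0>0$. Let $L_n$ be the Legendre polynomials on $[-1,1]$ ($L_0=1$, $L_1(\eta)=\eta$, $(2n+1)\eta L_n=(n+1)L_{n+1}+nL_{n-1}$), $\phi_n(v)=\sqrt{2n+1}\,L_n\big((2v-(v_a+v_b))/(v_b-v_a)\big)$, $\boldsymbol\phi=(\phi_0,\dots,\phi_{N_L-1})^T$, $\psi_k(x)=e^{2\pi i kx/L}$. Constants: $\overline\sigma=\frac{v_a+v_b}{2}$, $\sigma_0=0$, $\sigma_n=\frac{v_b-v_a}{2}\frac{n}{\sqrt{(2n+1)(2n-1)}}$ for $n\ge1$; $\sigma_{n,i}=\pi_{n,i}\frac{2\sqrt{(2n+1)(2i+1)}}{v_b-v_a}$ with $\pi_{n,i}=0$ if $n-i$ is even, $1$ if odd. $f^s(x,v,t)=\sum_{n=0}^{N_L-1}C^s_n(x,t)\phi_n(v)$, $C^s_n(x,t)=\sum_{k=-N_F}^{N_F}C^s_{n,k}(t)\psi_k(x)$ (real-valued), $\mathbf{C}^s=(C^s_n)_{n=0}^{N_L-1}$, $\mathbf{C}^s_k=(C^s_{n,k})_{n=0}^{N_L-1}$, with conventions $C^s_{-1}=C^s_{N_L}=0$. Matrices: $(\mathbb{A}\mathbf{C}^s_k)_n=\sigma_{n+1}C^s_{n+1,k}+\sigma_nC^s_{n-1,k}+\overline\sigma C^s_{n,k}$; $(\mathbb{B}\mathbf{C}^s)_n=\sum_{i=0}^{n-1}\sigma_{n,i}C^s_i$;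 $\mathbb{D}^s_\nu$ is diagonal with entries $D^s_n=-\nu_s\frac{n(n-1)(n-2)}{(N_L-1)(N_L-2)(N_L-3)}$. The electric field $E(x,t)=\sum_{k=-N_F}^{N_F}E_k(t)\psi_k(x)$ is real-valued, with $E_0=0$ and (Poisson equation) $\epsilon_0\big(\frac{2\pi i}{L}k\big)E_k=(v_b-v_a)\sum_{s\in\{e,i\}}q^sC^s_{0,k}$ for $k\ne0$. For $g(x,v,t)$, $\delta_v[g]_{v_a}^{v_b}=\frac{g(x,v_b,t)-g(x,v_a,t)}{v_b-v_a}$. For a trigonometric polynomial $h(x)$ (possibly vector-valued) with Fourier coefficients $h_j=\frac1L\int_0^Lh\,\psi_{-j}\,dx$, $[E\star h]_k=\sum_{k'=-N_F}^{N_F}E_{k'}h_{k-k'}$. By orthogonality, $\int_0^L\int_{v_a}^{v_b}|f^s|^2\,dv\,dx=(v_b-v_a)L\sum_{n,k}|C^s_{n,k}|^2$, which is why the stated inequality is called $L^2$ stability. *)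

theory Defs
  imports "HOL-Analysis.Analysis"
begin

text \<open>
  The state of one species at a fixed time is an array \<open>c :: nat \<Rightarrow> int \<Rightarrow> complex\<close>, where
  \<open>c n k\<close> is the coefficient of \<open>\<phi>\<^sub>n(v) \<psi>\<^sub>k(x)\<close>. Only the entries with \<open>n < N\<^sub>L\<close> and
  \<open>-N\<^sub>F \<le> k \<le> N\<^sub>F\<close> are meaningful, and no definition below reads any other entry
  when its own indices lie in that range.
\<close>

datatype species = Electron | Ion

text \<open>The last equation is the three-term recurrence with \<open>n + 1\<close> in place of \<open>n\<close>.\<close>

fun legendre :: "nat \<Rightarrow> real \<Rightarrow> real" where
  "legendre 0 x = 1"
| "legendre (Suc 0) x = x"
| "legendre (Suc (Suc n)) x =
     ((2 * real n + 3) * x * legendre (Suc n) x - (real n + 1) * legendre n x) / (real n + 2)"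

definition legendre_basis :: "real \<Rightarrow> real \<Rightarrow> nat \<Rightarrow> real \<Rightarrow> real" where
  "legendre_basis va vb n v =
     sqrt (2 * real n + 1) * legendre n ((2 * v - (va + vb)) / (vb - va))"

definition fourier_mode :: "real \<Rightarrow> int \<Rightarrow> real \<Rightarrow> complex" where
  "fourier_mode L k x = exp (2 * of_real pi * \<i> * of_int k * of_real x / of_real L)"

definition trig_poly :: "real \<Rightarrow> nat \<Rightarrow> (int \<Rightarrow> complex) \<Rightarrow> real \<Rightarrow> complex" where
  "trig_poly L NF a x = (\<Sum>k = - int NF..int NF. a k * fourier_mode L k x)"

definition fourier_coeff :: "real \<Rightarrow> (real \<Rightarrow> complex) \<Rightarrow> int \<Rightarrow> complex" where
  "fourier_coeff L h j = (1 / of_real L) * integral {0..L} (\<lambda>x. h x * fourier_mode L (- j) x)"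

definition distribution ::
  "real \<Rightarrow> real \<Rightarrow> real \<Rightarrow> nat \<Rightarrow> nat \<Rightarrow> (nat \<Rightarrow> int \<Rightarrow> complex) \<Rightarrow> real \<Rightarrow> real \<Rightarrow> complex"
where
  "distribution L va vb NL NF c x v =
     (\<Sum>n<NL. trig_poly L NF (c n) x * of_real (legendre_basis va vb n v))"

definition sigma_bar :: "real \<Rightarrow> real \<Rightarrow> real" where
  "sigma_bar va vb = (va + vb) / 2"

definition sigma1 :: "real \<Rightarrow> real \<Rightarrow> nat \<Rightarrow> real" where
  "sigma1 va vb n =
     (if n = 0 then 0
      else (vb - va) / 2 * (real n / sqrt ((2 * real n + 1) * (2 * real n - 1))))"

definition sigma2 :: "real \<Rightarrow> real \<Rightarrow> nat \<Rightarrow> nat \<Rightarrow> real" where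
  "sigma2 va vb n i =
     (if even (int n - int i) then 0 else 1) *
     (2 * sqrt ((2 * real n + 1) * (2 * real i + 1)) / (vb - va))"

text \<open>The conditionals implement the conventions \<open>C\<^sub>-\<^sub>1 = C\<^bsub>N\<^sub>L\<^esub> = 0\<close>.\<close>

definition op_A :: "real \<Rightarrow> real \<Rightarrow> nat \<Rightarrow> (nat \<Rightarrow> complex) \<Rightarrow> nat \<Rightarrow> complex" where
  "op_A va vb NL a n =
     of_real (sigma1 va vb (n + 1)) * (if n + 1 < NL then a (n + 1) else 0)
     + of_real (sigma1 va vb n) * (if n = 0 then 0 else a (n - 1))
     + of_real (sigma_bar va vb) * a n"

definition op_B :: "real \<Rightarrow> real \<Rightarrow> (nat \<Rightarrow> complex) \<Rightarrow> nat \<Rightarrow> complex" where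
  "op_B va vb a n = (\<Sum>i<n. of_real (sigma2 va vb n i) * a i)"

definition diag_D :: "nat \<Rightarrow> real \<Rightarrow> nat \<Rightarrow> real" where
  "diag_D NL \<nu> n =
     - \<nu> * ((real n * (real n - 1) * (real n - 2))
            / ((real NL - 1) * (real NL - 2) * (real NL - 3)))"

definition delta_v :: "real \<Rightarrow> real \<Rightarrow> (real \<Rightarrow> complex) \<Rightarrow> complex" where
  "delta_v va vb g = (g vb - g va) / of_real (vb - va)"

definition field_conv ::
  "real \<Rightarrow> nat \<Rightarrow> (int \<Rightarrow> complex) \<Rightarrow> (real \<Rightarrow> complex) \<Rightarrow> int \<Rightarrow> complex"
where
  "field_conv L NF E h k = (\<Sum>k' = - int NF..int NF. E k' * fourier_coeff L h (k - k'))"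

text \<open>The \<open>n\<close>-th component, at \<open>x\<close>, of \<open>B C - \<gamma> \<delta>\<^sub>v[f \<phi>]\<close>.\<close>

definition penalized_term ::
  "real \<Rightarrow> real \<Rightarrow> real \<Rightarrow> nat \<Rightarrow> nat \<Rightarrow> real \<Rightarrow> (nat \<Rightarrow> int \<Rightarrow> complex) \<Rightarrow> nat \<Rightarrow> real \<Rightarrow> complex"
where
  "penalized_term L va vb NL NF \<gamma> c n x =
     op_B va vb (\<lambda>i. trig_poly L NF (c i) x) n
     - of_real \<gamma> *
       delta_v va vb (\<lambda>v. distribution L va vb NL NF c x v * of_real (legendre_basis va vb n v))"

definition poisson_eq ::
  "real \<Rightarrow> real \<Rightarrow> real \<Rightarrow> nat \<Rightarrow> real \<Rightarrow> (species \<Rightarrow> real) \<Rightarrow>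
   (species \<Rightarrow> nat \<Rightarrow> int \<Rightarrow> complex) \<Rightarrow> (int \<Rightarrow> complex) \<Rightarrow> bool"
where
  "poisson_eq L va vb NF eps0 q c E \<longleftrightarrow>
     E 0 = 0 \<and>
     (\<forall>k\<in>{- int NF..int NF}. k \<noteq> 0 \<longrightarrow>
        of_real eps0 * (2 * of_real pi * \<i> / of_real L * of_int k) * E k
        = of_real (vb - va) * (\<Sum>s\<in>{Electron, Ion}. of_real (q s) * c s 0 k))"

text \<open>
  \<open>C t s n k\<close> is the coefficient of species \<open>s\<close> at time \<open>t\<close>, and \<open>E t k\<close> the \<open>k\<close>-th
  Fourier coefficient of the electric field. Time ranges over an interval \<open>I\<close>; derivatives are
  taken within \<open>I\<close>, hence are one-sided at the endpoints that belong to \<open>I\<close>.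
\<close>

definition vlasov_eq ::
  "real \<Rightarrow> real \<Rightarrow> real \<Rightarrow> nat \<Rightarrow> nat \<Rightarrow> (species \<Rightarrow> real) \<Rightarrow> (species \<Rightarrow> real) \<Rightarrow>
   (species \<Rightarrow> real) \<Rightarrow> (species \<Rightarrow> real) \<Rightarrow> real set \<Rightarrow>
   (real \<Rightarrow> species \<Rightarrow> nat \<Rightarrow> int \<Rightarrow> complex) \<Rightarrow> (real \<Rightarrow> int \<Rightarrow> complex) \<Rightarrow> bool"
where
  "vlasov_eq L va vb NL NF m q \<gamma> \<nu> I C E \<longleftrightarrow>
     (\<forall>t\<in>I. \<forall>s. \<forall>n<NL. \<forall>k\<in>{- int NF..int NF}.
        \<exists>C'. ((\<lambda>\<tau>. C \<tau> s n k) has_vector_derivative C') (at t within I) \<and>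
          C' + (2 * of_real pi * \<i> / of_real L * of_int k)
                 * op_A va vb NL (\<lambda>j. C t s j k) n
             - of_real (q s / m s)
                 * field_conv L NF (E t) (penalized_term L va vb NL NF (\<gamma> s) (C t s) n) k
          = of_real (diag_D NL (\<nu> s) n) * C t s n k)"

definition vlasov_poisson_solution ::
  "real \<Rightarrow> real \<Rightarrow> real \<Rightarrow> nat \<Rightarrow> nat \<Rightarrow> real \<Rightarrow> (species \<Rightarrow> real) \<Rightarrow> (species \<Rightarrow> real) \<Rightarrow>
   (species \<Rightarrow> real) \<Rightarrow> (species \<Rightarrow> real) \<Rightarrow> real set \<Rightarrow>
   (real \<Rightarrow> species \<Rightarrow> nat \<Rightarrow> int \<Rightarrow> complex) \<Rightarrow> (real \<Rightarrow> int \<Rightarrow> complex) \<Rightarrow> bool"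
where
  "vlasov_poisson_solution L va vb NL NF eps0 m q \<gamma> \<nu> I C E \<longleftrightarrow>
     vlasov_eq L va vb NL NF m q \<gamma> \<nu> I C E \<and>
     (\<forall>t\<in>I. poisson_eq L va vb NF eps0 q (C t) (E t)) \<and>
     (\<forall>t\<in>I. \<forall>s. \<forall>n<NL. \<forall>x. trig_poly L NF (C t s n) x \<in> \<real>) \<and>
     (\<forall>t\<in>I. \<forall>x. trig_poly L NF (E t) x \<in> \<real>)"

end

theory Submission
  imports Defs
begin

text \<open>
  The time derivative of \<open>\<Sum>\<^sub>n\<^sub>,\<^sub>k |C\<^sub>n\<^sub>,\<^sub>k|\<^sup>2\<close> is \<open>2 Re (\<Sum>\<^sub>n\<^sub>,\<^sub>k cnj C\<^sub>n\<^sub>,\<^sub>k C'\<^sub>n\<^sub>,\<^sub>k)\<close>, and each of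
  the three terms of the equation for \<open>C'\<^sub>n\<^sub>,\<^sub>k\<close> is treated separately.

  Advection: the tridiagonal matrix \<open>A\<close> is real and symmetric, so its quadratic form is real
  (\<open>op_A_form_real\<close>) and the imaginary factor \<open>2 \<pi> i k / L\<close> makes its contribution purely
  imaginary.

  Electric field: pairing the Fourier coefficients of \<open>E P\<^sub>n\<close>, where \<open>P\<^sub>n\<close> is the penalized
  term, with those of \<open>C\<^sub>n\<close> gives the mean over one period of \<open>cnj C\<^sub>n(x) E(x) P\<^sub>n(x)\<close>
  (\<open>field_conv_pairing\<close>). Since \<open>C\<^sub>n(x)\<close> is real, it is enough that
  \<open>\<Sum>\<^sub>n C\<^sub>n(x) P\<^sub>n(x)\<close> vanishes at every \<open>x\<close> (\<open>penalized_term_orthogonal\<close>). This is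
  where \<open>\<gamma> = 1/2\<close> enters: because \<open>L\<^sub>n(1) = 1\<close> and \<open>L\<^sub>n(-1) = (-1)\<^sup>n\<close>, the matrix of the
  quadratic form \<open>f(v\<^sub>b)\<^sup>2 - f(v\<^sub>a)\<^sup>2\<close> is \<open>v\<^sub>b - v\<^sub>a\<close> times \<open>B + B\<^sup>T\<close>, so the quadratic form
  of \<open>B\<close> equals one half of \<open>\<delta>\<^sub>v[f\<^sup>2]\<close>. The cancellation is pointwise in \<open>x\<close> and holds for
  any field; the Poisson equation plays no role in it.

  Penalization: the diagonal entries \<open>D\<^sub>n\<close> are nonpositive, which leaves the stated dissipation
  rate. The norm is therefore nonincreasing, by the mean value theorem.
\<close>

section \<open>Legendre polynomials at the end points\<close>

lemma legendre_at_1: "legendre n 1 = 1"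
  by (induction n "1::real" rule: legendre.induct) (auto simp: field_simps)

lemma legendre_at_minus_1: "legendre n (- 1) = (- 1) ^ n"
  by (induction n "- 1::real" rule: legendre.induct) (auto simp: field_simps)

lemma legendre_basis_right:
  assumes "va < vb"
  shows "legendre_basis va vb n vb = sqrt (2 * real n + 1)"
proof -
  have "(2 * vb - (va + vb)) / (vb - va) = 1"
    using assms by (simp add: field_simps)
  then show ?thesis
    by (simp add: legendre_basis_def legendre_at_1)
qed

lemma legendre_basis_left:
  assumes "va < vb"
  shows "legendre_basis va vb n va = sqrt (2 * real n + 1) * (- 1) ^ n"
proof -
  have "(2 * va - (va + vb)) / (vb - va) = - 1"
    using assms by (simp add: field_simps)
  then show ?thesis
    by (simp add: legendre_basis_def legendre_at_minus_1)
qed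

section \<open>The penalized term does no work\<close>

lemma sum_symmetric_square:
  fixes f :: "nat \<Rightarrow> nat \<Rightarrow> 'a::comm_ring_1"
  assumes "\<And>i j. f i j = f j i" and "\<And>i. f i i = 0"
  shows "(\<Sum>n<N. \<Sum>i<N. f n i) = 2 * (\<Sum>n<N. \<Sum>i<n. f n i)"
proof (induction N)
  case (Suc N)
  have "(\<Sum>n<N. f n N) = (\<Sum>n<N. f N n)"
    using assms(1) by (intro sum.cong) auto
  with Suc show ?case
    by (simp add: sum.distrib assms(2) algebra_simps)
qed simp

text \<open>
  The boundary values of the basis reproduce the entries of \<open>B\<close>: the products
  \<open>\<phi>\<^sub>n \<phi>\<^sub>i\<close> agree at both end points if \<open>n - i\<close> is even and differ by their sign otherwise.
\<close>

lemma legendre_basis_jump: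
  assumes "va < vb"
  shows "legendre_basis va vb n vb * legendre_basis va vb i vb
           - legendre_basis va vb n va * legendre_basis va vb i va
         = (vb - va) * sigma2 va vb n i"
proof -
  have sign: "(- 1 :: real) ^ n * (- 1) ^ i = (if even (int n - int i) then 1 else - 1)"
    by (simp flip: power_add)
  have "sqrt (2 * real n + 1) * (- 1) ^ n * (sqrt (2 * real i + 1) * (- 1) ^ i)
        = ((- 1) ^ n * (- 1) ^ i) * sqrt ((2 * real n + 1) * (2 * real i + 1))"
    by (simp add: real_sqrt_mult)
  note left = this[unfolded sign]
  show ?thesis
    unfolding legendre_basis_right[OF assms] legendre_basis_left[OF assms] left sigma2_def
    using assms by (auto simp: real_sqrt_mult)
qed

lemma op_B_form:
  assumes "va < vb"
  shows "2 * (\<Sum>n<N. a n * op_B va vb a n)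
         = (\<Sum>n<N. \<Sum>i<N. of_real (sigma2 va vb n i) * a n * a i)"
proof -
  have "(\<Sum>n<N. \<Sum>i<N. of_real (sigma2 va vb n i) * a n * a i)
        = 2 * (\<Sum>n<N. \<Sum>i<n. of_real (sigma2 va vb n i) * a n * a i)"
    by (rule sum_symmetric_square) (auto simp: sigma2_def mult_ac)
  then show ?thesis
    by (simp add: op_B_def sum_distrib_left mult_ac)
qed

lemma penalized_term_orthogonal:
  assumes "va < vb"
  shows "(\<Sum>n<NL. trig_poly L NF (c n) x * penalized_term L va vb NL NF (1/2) c n x) = 0"
proof -
  define a where "a n = trig_poly L NF (c n) x" for n
  define \<phi> where "\<phi> n v = complex_of_real (legendre_basis va vb n v)" for n v
  define w where "w = complex_of_real (vb - va)"
  have w: "w \<noteq> 0"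
    using assms by (simp add: w_def)
  have jump: "\<phi> n vb * \<phi> i vb - \<phi> n va * \<phi> i va = w * of_real (sigma2 va vb n i)" for n i
    using arg_cong[OF legendre_basis_jump[OF assms, of n i], of complex_of_real]
    by (simp add: \<phi>_def w_def)
  have f: "distribution L va vb NL NF c x v = (\<Sum>i<NL. a i * \<phi> i v)" for v
    by (simp add: distribution_def a_def \<phi>_def)
  have "(\<Sum>n<NL. a n * delta_v va vb (\<lambda>v. distribution L va vb NL NF c x v * \<phi> n v))
        = (\<Sum>n<NL. \<Sum>i<NL. a n * a i * ((\<phi> n vb * \<phi> i vb - \<phi> n va * \<phi> i va) / w))"
    unfolding delta_v_def f w_def[symmetric]
    by (intro sum.cong refl)
      (simp add: sum_distrib_left sum_distrib_right sum_divide_distrib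
        sum_subtractf[symmetric] diff_divide_distrib algebra_simps)
  also have "\<dots> = (\<Sum>n<NL. \<Sum>i<NL. of_real (sigma2 va vb n i) * a n * a i)"
    using w by (simp add: jump mult_ac)
  also have "\<dots> = 2 * (\<Sum>n<NL. a n * op_B va vb a n)"
    by (rule op_B_form[OF assms, symmetric])
  finally have boundary:
    "(\<Sum>n<NL. a n * delta_v va vb (\<lambda>v. distribution L va vb NL NF c x v * \<phi> n v))
      = 2 * (\<Sum>n<NL. a n * op_B va vb a n)" .
  have "(\<Sum>n<NL. a n * penalized_term L va vb NL NF (1/2) c n x)
      = (\<Sum>n<NL. a n * op_B va vb a n)
        - 1/2 * (\<Sum>n<NL. a n * delta_v va vb (\<lambda>v. distribution L va vb NL NF c x v * \<phi> n v))"
    unfolding penalized_term_def a_def[symmetric] \<phi>_def[symmetric]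
    by (simp add: algebra_simps sum_subtractf sum_divide_distrib)
  then show ?thesis
    unfolding boundary by (simp add: a_def)
qed

section \<open>The convolution with the electric field\<close>

lemma fourier_mode_add: "fourier_mode L (j + k) x = fourier_mode L j x * fourier_mode L k x"
  by (simp add: fourier_mode_def algebra_simps add_divide_distrib flip: exp_add)

lemma cnj_fourier_mode: "cnj (fourier_mode L k x) = fourier_mode L (- k) x"
  by (simp add: fourier_mode_def exp_cnj)

lemma continuous_on_fourier_mode [continuous_intros]: "continuous_on S (fourier_mode L k)"
proof -
  define c where "c = 2 * of_real pi * \<i> * of_int k / complex_of_real L"
  have "fourier_mode L k = (\<lambda>x. exp (c * of_real x))"
    by (simp add: fourier_mode_def c_def fun_eq_iff)
  then show ?thesis
    by (simp add: continuous_intros)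
qed

lemma continuous_on_trig_poly [continuous_intros]: "continuous_on S (trig_poly L NF a)"
  unfolding trig_poly_def by (intro continuous_intros)

lemma continuous_on_penalized_term: "continuous_on S (penalized_term L va vb NL NF \<gamma> c n)"
proof (cases "va = vb")
  case True
  then show ?thesis
    unfolding penalized_term_def op_B_def delta_v_def
    by (simp add: continuous_intros)
next
  case False
  then show ?thesis
    unfolding penalized_term_def op_B_def delta_v_def distribution_def
    by (intro continuous_intros) simp
qed

text \<open>
  No orthogonality of the Fourier modes is needed: all modes of \<open>c\<close> and \<open>e\<close> are collected
  under the integral that defines the coefficients of \<open>h\<close>.
\<close>

lemma field_conv_pairing:
  assumes "continuous_on {0..L} h"
  shows "(\<Sum>k = - int NF..int NF. cnj (c k) * field_conv L NF e h k)
         = 1 / of_real L * integral {0..L} (\<lambda>x. cnj (trig_poly L NF c x) * trig_poly L NF e x * h x)"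
proof -
  let ?K = "{- int NF..int NF}"
  have intg: "(\<lambda>x. cnj (c k) * (e j * (h x * fourier_mode L (- (k - j)) x))) integrable_on {0..L}"
    for k j
    by (intro integrable_continuous_real continuous_intros assms)
  have expand: "cnj (trig_poly L NF c x) * trig_poly L NF e x * h x
      = (\<Sum>k\<in>?K. \<Sum>j\<in>?K. cnj (c k) * (e j * (h x * fourier_mode L (- (k - j)) x)))" for x
  proof -
    have "fourier_mode L (- (k - j)) x = fourier_mode L (- k) x * fourier_mode L j x" for k j
      using fourier_mode_add[of L "- k" j x] by (simp add: algebra_simps)
    then show ?thesis
      by (simp add: trig_poly_def cnj_fourier_mode sum_product sum_distrib_right sum_distrib_left mult_ac)
  qed
  have "integral {0..L} (\<lambda>x. cnj (trig_poly L NF c x) * trig_poly L NF e x * h x)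
      = (\<Sum>k\<in>?K. \<Sum>j\<in>?K.
          cnj (c k) * (e j * integral {0..L} (\<lambda>x. h x * fourier_mode L (- (k - j)) x)))"
    unfolding expand
    by (simp only: integral_sum integrable_sum intg finite_atLeastAtMost_int integral_mult_right)
  then show ?thesis
    by (simp add: field_conv_def fourier_coeff_def sum_distrib_left sum_divide_distrib mult_ac)
qed

lemma field_term_vanishes:
  assumes "va < vb"
    and "\<And>n x. n < NL \<Longrightarrow> trig_poly L NF (c n) x \<in> \<real>"
  shows "(\<Sum>n<NL. \<Sum>k = - int NF..int NF. cnj (c n k) *
            field_conv L NF e (penalized_term L va vb NL NF (1/2) c n) k) = 0"
proof -
  let ?P = "penalized_term L va vb NL NF (1/2) c" and ?T = "\<lambda>n. trig_poly L NF (c n)"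
  have "(\<Sum>n<NL. \<Sum>k = - int NF..int NF. cnj (c n k) * field_conv L NF e (?P n) k)
        = (\<Sum>n<NL. 1 / of_real L * integral {0..L} (\<lambda>x. cnj (?T n x) * trig_poly L NF e x * ?P n x))"
    by (simp add: field_conv_pairing continuous_on_penalized_term)
  also have "\<dots> = 1 / of_real L *
      integral {0..L} (\<lambda>x. \<Sum>n<NL. cnj (?T n x) * trig_poly L NF e x * ?P n x)"
    unfolding sum_distrib_left[symmetric]
    by (subst integral_sum)
      (auto intro!: integrable_continuous_real continuous_intros continuous_on_penalized_term)
  also have "(\<lambda>x. \<Sum>n<NL. cnj (?T n x) * trig_poly L NF e x * ?P n x) = (\<lambda>x. 0)"
  proof
    fix x
    have "(\<Sum>n<NL. cnj (?T n x) * trig_poly L NF e x * ?P n x)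
        = trig_poly L NF e x * (\<Sum>n<NL. ?T n x * ?P n x)"
      unfolding sum_distrib_left
      by (intro sum.cong) (auto simp: Reals_cnj_iff[THEN iffD1, OF assms(2)])
    then show "(\<Sum>n<NL. cnj (?T n x) * trig_poly L NF e x * ?P n x) = 0"
      by (simp add: penalized_term_orthogonal[OF assms(1)])
  qed
  finally show ?thesis
    by simp
qed

section \<open>Advection and penalization\<close>

lemma op_A_form_real: "Im (\<Sum>n<NL. cnj (a n) * op_A va vb NL a n) = 0"
proof (cases NL)
  case (Suc M)
  define u where "u n = of_real (sigma1 va vb (n + 1)) * cnj (a n) * a (n + 1)" for n
  have "(\<Sum>n<NL. cnj (a n) * op_A va vb NL a n)
      = (\<Sum>n<NL. if n + 1 < NL then u n else 0)
        + (\<Sum>n<NL. if n = 0 then 0 else cnj (u (n - 1)))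
        + (\<Sum>n<NL. of_real (sigma_bar va vb) * (cnj (a n) * a n))"
    unfolding sum.distrib[symmetric]
    by (intro sum.cong) (auto simp: op_A_def u_def algebra_simps)
  also have "(\<Sum>n<NL. if n + 1 < NL then u n else 0) = (\<Sum>n<M. u n)"
    unfolding Suc by simp
  also have "(\<Sum>n<NL. if n = 0 then 0 else cnj (u (n - 1))) = cnj (\<Sum>n<M. u n)"
    unfolding Suc by (simp add: sum.lessThan_Suc_shift del: sum.lessThan_Suc)
  finally show ?thesis
    by (simp add: sum_negf algebra_simps)
qed simp

lemma diag_D_nonpos:
  assumes "NL \<ge> 4" and "\<nu> \<ge> 0"
  shows "diag_D NL \<nu> n \<le> 0"
proof -
  \<comment> \<open>For \<open>n < 2\<close> some factors are negative, but another one vanishes.\<close>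
  have "real n * (real n - 1) * (real n - 2) \<ge> 0"
  proof (cases "n \<ge> 2")
    case False
    then have "n = 0 \<or> n = 1"
      by auto
    then show ?thesis
      by auto
  qed simp
  then show ?thesis
    using assms by (auto simp: diag_D_def intro!: mult_nonneg_nonneg divide_nonneg_nonneg)
qed

section \<open>Energy balance and stability\<close>

lemma has_real_derivative_cmod_squared:
  assumes "(f has_vector_derivative f') (at t within S)"
  shows "((\<lambda>\<tau>. (cmod (f \<tau>))\<^sup>2) has_real_derivative 2 * Re (cnj (f t) * f')) (at t within S)"
proof -
  have "((\<lambda>\<tau>. f \<tau> \<bullet> f \<tau>) has_derivative (\<lambda>h. f t \<bullet> (h *\<^sub>R f') + (h *\<^sub>R f') \<bullet> f t)) (at t within S)"
    using assms unfolding has_vector_derivative_def by (intro has_derivative_inner)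
  moreover have "(\<lambda>h. f t \<bullet> (h *\<^sub>R f') + (h *\<^sub>R f') \<bullet> f t) = (*) (2 * Re (cnj (f t) * f'))"
    by (simp add: fun_eq_iff inner_complex_def algebra_simps)
  ultimately show ?thesis
    by (simp add: has_field_derivative_def power2_norm_eq_inner)
qed

lemma nonincreasing_if_deriv_nonpos:
  fixes f :: "real \<Rightarrow> real"
  assumes "a \<le> b"
    and "\<And>x. x \<in> {a..b} \<Longrightarrow> (f has_real_derivative f' x) (at x within {a..b})"
    and "\<And>x. x \<in> {a..b} \<Longrightarrow> f' x \<le> 0"
  shows "f b \<le> f a"
proof -
  have "\<exists>x\<in>{a..b}. f b - f a = f' x * (b - a)"
    using assms(2) by (intro mvt_very_simple[OF assms(1)]) (auto simp: has_field_derivative_def)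
  then obtain x where "x \<in> {a..b}" "f b - f a = f' x * (b - a)" ..
  moreover have "f' x * (b - a) \<le> 0"
    using assms(1) assms(3)[OF \<open>x \<in> {a..b}\<close>] by (simp add: mult_nonpos_nonneg)
  ultimately show ?thesis
    by simp
qed

lemma energy_balance:
  assumes "va < vb" and "NL \<ge> 4" and "\<gamma> s = 1 / 2" and "\<nu> s \<ge> 0" and "t \<in> I"
    and "vlasov_eq L va vb NL NF m q \<gamma> \<nu> I C E"
    and reality: "\<And>n x. n < NL \<Longrightarrow> trig_poly L NF (C t s n) x \<in> \<real>"
  shows "((\<lambda>\<tau>. \<Sum>n<NL. \<Sum>k = - int NF..int NF. (cmod (C \<tau> s n k))\<^sup>2)
            has_real_derivative
            - 2 * (\<Sum>n<NL. \<bar>diag_D NL (\<nu> s) n\<bar>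
                     * (\<Sum>k = - int NF..int NF. (cmod (C t s n k))\<^sup>2)))
          (at t within I)"
proof -
  let ?K = "{- int NF..int NF}"
  define A where "A n k = cnj (C t s n k) * op_A va vb NL (\<lambda>j. C t s j k) n" for n k
  define F where
    "F n k = cnj (C t s n k) * field_conv L NF (E t) (penalized_term L va vb NL NF (1/2) (C t s) n) k"
    for n k
  define r where "r k = 2 * pi / L * real_of_int k" for k
  have "\<forall>n k. \<exists>C'. n < NL \<longrightarrow> k \<in> ?K \<longrightarrow>
      ((\<lambda>\<tau>. C \<tau> s n k) has_vector_derivative C') (at t within I) \<and>
          C' + (2 * of_real pi * \<i> / of_real L * of_int k) * op_A va vb NL (\<lambda>j. C t s j k) n
             - of_real (q s / m s)
                 * field_conv L NF (E t) (penalized_term L va vb NL NF (\<gamma> s) (C t s) n) k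
          = of_real (diag_D NL (\<nu> s) n) * C t s n k"
    using assms(5,6) unfolding vlasov_eq_def by blast
  then obtain C' where
    deriv: "\<And>n k. n < NL \<Longrightarrow> k \<in> ?K \<Longrightarrow>
      ((\<lambda>\<tau>. C \<tau> s n k) has_vector_derivative C' n k) (at t within I)" and
    eq: "\<And>n k. n < NL \<Longrightarrow> k \<in> ?K \<Longrightarrow>
      C' n k + (2 * of_real pi * \<i> / of_real L * of_int k) * op_A va vb NL (\<lambda>j. C t s j k) n
             - of_real (q s / m s)
                 * field_conv L NF (E t) (penalized_term L va vb NL NF (\<gamma> s) (C t s) n) k
          = of_real (diag_D NL (\<nu> s) n) * C t s n k"
    by metis
  have rate: "Re (cnj (C t s n k) * C' n k)
      = r k * Im (A n k) + q s / m s * Re (F n k) + diag_D NL (\<nu> s) n * (cmod (C t s n k))\<^sup>2"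
    if "n < NL" "k \<in> ?K" for n k
  proof -
    have "C' n k = - (\<i> * of_real (r k)) * op_A va vb NL (\<lambda>j. C t s j k) n
         + of_real (q s / m s) * field_conv L NF (E t) (penalized_term L va vb NL NF (1/2) (C t s) n) k
         + of_real (diag_D NL (\<nu> s) n) * C t s n k"
      using eq[OF that] assms(3) by (simp add: r_def algebra_simps)
    then have "cnj (C t s n k) * C' n k = - (\<i> * of_real (r k)) * A n k + of_real (q s / m s) * F n k
         + of_real (diag_D NL (\<nu> s) n) * (C t s n k * cnj (C t s n k))"
      by (simp only: A_def F_def) (simp add: algebra_simps)
    then show ?thesis
      unfolding complex_norm_square[symmetric] by (simp del: of_real_power)
  qed
  have advection: "(\<Sum>n<NL. \<Sum>k\<in>?K. r k * Im (A n k)) = 0"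
  proof -
    have "(\<Sum>n<NL. \<Sum>k\<in>?K. r k * Im (A n k)) = (\<Sum>k\<in>?K. r k * Im (\<Sum>n<NL. A n k))"
      by (subst sum.swap) (simp add: sum_distrib_left)
    then show ?thesis
      unfolding A_def op_A_form_real by simp
  qed
  have field: "(\<Sum>n<NL. \<Sum>k\<in>?K. Re (F n k)) = 0"
  proof -
    have "(\<Sum>n<NL. \<Sum>k\<in>?K. F n k) = 0"
      unfolding F_def by (rule field_term_vanishes[OF assms(1) reality])
    from arg_cong[OF this, of Re] show ?thesis
      by simp
  qed
  have "(\<Sum>n<NL. \<Sum>k\<in>?K. 2 * Re (cnj (C t s n k) * C' n k))
      = (\<Sum>n<NL. \<Sum>k\<in>?K. 2 * (r k * Im (A n k) + q s / m s * Re (F n k)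
          + diag_D NL (\<nu> s) n * (cmod (C t s n k))\<^sup>2))"
    by (intro sum.cong refl) (simp only: rate lessThan_iff)
  also have "\<dots> = 2 * ((\<Sum>n<NL. \<Sum>k\<in>?K. r k * Im (A n k)) + q s / m s * (\<Sum>n<NL. \<Sum>k\<in>?K. Re (F n k))
        + (\<Sum>n<NL. diag_D NL (\<nu> s) n * (\<Sum>k\<in>?K. (cmod (C t s n k))\<^sup>2)))"
    by (simp only: sum.distrib distrib_left sum_distrib_left)
  also have "\<dots> = - 2 * (\<Sum>n<NL. \<bar>diag_D NL (\<nu> s) n\<bar> * (\<Sum>k\<in>?K. (cmod (C t s n k))\<^sup>2))"
    using diag_D_nonpos[OF assms(2,4)] by (simp add: advection field sum_negf abs_of_nonpos)
  finally show ?thesis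
    by (rule DERIV_cong[rotated])
      (intro DERIV_sum has_real_derivative_cmod_squared deriv; simp)
qed

theorem theorem3p2:
  fixes L va vb eps0 :: real
    and NL NF :: nat
    and m q \<gamma> \<nu> :: "species \<Rightarrow> real"
    and I :: "real set"
    and C :: "real \<Rightarrow> species \<Rightarrow> nat \<Rightarrow> int \<Rightarrow> complex"
    and E :: "real \<Rightarrow> int \<Rightarrow> complex"
  assumes "L > 0" and "va < vb" and "NL \<ge> 4" and "eps0 > 0"
    and "\<And>s. m s > 0"
    and "\<And>s. \<gamma> s = 1 / 2"
    and "\<And>s. \<nu> s \<ge> 0"
    and "is_interval I" and "0 \<in> I"
    and "vlasov_poisson_solution L va vb NL NF eps0 m q \<gamma> \<nu> I C E"
  shows "(\<forall>s. \<forall>t\<in>I. t \<ge> 0 \<longrightarrow>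
            (\<Sum>n<NL. \<Sum>k = - int NF..int NF. (cmod (C t s n k))\<^sup>2)
              \<le> (\<Sum>n<NL. \<Sum>k = - int NF..int NF. (cmod (C 0 s n k))\<^sup>2)) \<and>
         (\<forall>s. \<forall>t\<in>I.
            ((\<lambda>\<tau>. \<Sum>n<NL. \<Sum>k = - int NF..int NF. (cmod (C \<tau> s n k))\<^sup>2)
              has_real_derivative
              - 2 * (\<Sum>n<NL. \<bar>diag_D NL (\<nu> s) n\<bar>
                       * (\<Sum>k = - int NF..int NF. (cmod (C t s n k))\<^sup>2)))
            (at t within I))"
proof -
  let ?N = "\<lambda>s t. \<Sum>n<NL. \<Sum>k = - int NF..int NF. (cmod (C t s n k))\<^sup>2"
  let ?R = "\<lambda>s t. - 2 * (\<Sum>n<NL. \<bar>diag_D NL (\<nu> s) n\<bar>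
                       * (\<Sum>k = - int NF..int NF. (cmod (C t s n k))\<^sup>2))"
  have balance: "(?N s has_real_derivative ?R s t) (at t within I)" if "t \<in> I" for s t
  proof (rule energy_balance[OF assms(2,3,6,7) that])
    show "vlasov_eq L va vb NL NF m q \<gamma> \<nu> I C E"
      using assms(10) unfolding vlasov_poisson_solution_def by blast
    show "trig_poly L NF (C t s n) x \<in> \<real>" if "n < NL" for n x
      using assms(10) \<open>t \<in> I\<close> that unfolding vlasov_poisson_solution_def by blast
  qed
  have "?N s t \<le> ?N s 0" if t: "t \<in> I" "t \<ge> 0" for s t
  proof (rule nonincreasing_if_deriv_nonpos[OF t(2)])
    have sub: "{0..t} \<subseteq> I"
      using assms(8,9) t(1) unfolding is_interval_1 by (meson atLeastAtMost_iff subsetI)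
    show "(?N s has_real_derivative ?R s x) (at x within {0..t})" if "x \<in> {0..t}" for x
      using balance sub that by (intro has_field_derivative_subset[OF _ sub]) auto
    show "?R s x \<le> 0" for x
      by (auto intro!: sum_nonneg mult_nonneg_nonneg)
  qed
  then show ?thesis
    by (intro conjI allI ballI impI balance)
qed

end
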